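(* Let $n \ge 2$ and $1 \le m \le 2n-2$ be integers. The set of norm retrievable frames $\{f_k\}_{k=1}^m$ in $\mathbb{R}^n$ is not dense in the set of all $m$-element families of vectors in $\mathbb{R}^n$. That is, there exist vectors $x_1,\dots,x_m \in \mathbb{R}^n$ and $\epsilon > 0$ such that no family $\{y_k\}_{k=1}^m$ of vectors in $\mathbb{R}^n$ with $\sum_{k=1}^m \|x_k - y_k\| < \epsilon$ is a frame for $\mathbb{R}^n$ that does norm retrieval.
   Context: $\mathbb{R}^n$ is the $n$-dimensional real Hilbert space. A finite family of vectors $\{f_k\}_{k=1}^m$ in $\mathbb{R}^n$ is a frame if there are constants $0<A\le B<\infty$ with $A\|f\|^2 \le \sum_{k=1}^m |\langle f,f_k\rangle|^2 \le B\|f\|^2$ for all $f\in\mathbb{R}^n$ (equivalently, it spans $\mathbb{R}^n$). A family $\{f_k\}_{k=1}^m$ in $\mathbb{R}^n$ does norm retrieval (is norm retrievable) if whenever $x,y\in\mathbb{R}^n$ satisfy $|\langle x,f_k\rangle| = |\langle y,f_k\rangle|$ for all $k$, then $\|x\|=\|y\|$. Families are indexed, and closeness of two $m$-element families is measured by $\sum_{k=1}^m \|x_k-y_k\|$. *)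

theory Defs
  imports "HOL-Analysis.Analysis"
begin

definition frame_on :: "'i set \<Rightarrow> ('i \<Rightarrow> 'a::real_inner) \<Rightarrow> bool" where
  "frame_on I f \<longleftrightarrow>
    (\<exists>A B::real. 0 < A \<and> A \<le> B \<and>
      (\<forall>x. A * (norm x)\<^sup>2 \<le> (\<Sum>k\<in>I. \<bar>x \<bullet> f k\<bar>\<^sup>2) \<and>
           (\<Sum>k\<in>I. \<bar>x \<bullet> f k\<bar>\<^sup>2) \<le> B * (norm x)\<^sup>2))"

definition norm_retrieval_on :: "'i set \<Rightarrow> ('i \<Rightarrow> 'a::real_inner) \<Rightarrow> bool" where
  "norm_retrieval_on I f \<longleftrightarrow>
    (\<forall>x y. (\<forall>k\<in>I. \<bar>x \<bullet> f k\<bar> = \<bar>y \<bullet> f k\<bar>) \<longrightarrow> norm x = norm y)"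

end

(* Norm retrieval fails as soon as the index set splits into two parts J, K admitting vectors
   u orthogonal to the family on J, v orthogonal to the family on K, with u and v not orthogonal
   to each other: u + v and u - v then have the same measurements but different norms.
   Since m <= 2 (n - 1), one can let both parts of the family x consist of distinct standard basis
   vectors different from a fixed one e.  For every small perturbation of x, each part still has
   a unit normal vector close to the line through e, so the two normals are not orthogonal. *)

theory Submission
  imports Defs
begin

lemma norm_retrieval_on_orthogonal:
  assumes "norm_retrieval_on I f" "I \<subseteq> J \<union> K"
    and "\<And>k. k \<in> J \<Longrightarrow> u \<bullet> f k = 0" "\<And>k. k \<in> K \<Longrightarrow> v \<bullet> f k = 0"
  shows "u \<bullet> v = 0"
proof -
  have "\<bar>(u + v) \<bullet> f k\<bar> = \<bar>(u - v) \<bullet> f k\<bar>" if "k \<in> I" for k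
  proof -
    have "u \<bullet> f k = 0 \<or> v \<bullet> f k = 0"
      using assms(2-4) that by blast
    then show ?thesis
      by (auto simp: inner_add_left inner_diff_left)
  qed
  then have "norm (u + v) = norm (u - v)"
    using assms(1) unfolding norm_retrieval_on_def by blast
  \<comment> \<open>The two sides differ by four times \<open>u \<bullet> v\<close>.\<close>
  then have "(u + v) \<bullet> (u + v) = (u - v) \<bullet> (u - v)"
    by (simp add: norm_eq)
  then show ?thesis
    by (simp add: inner_add_left inner_add_right inner_diff_left inner_diff_right inner_commute)
qed

text \<open>Fewer than \<open>DIM('a)\<close> vectors have a common unit normal \<open>u\<close>.
  Any coordinate of \<open>u\<close> along \<open>h k\<close> equals
  \<open>u \<bullet> (h k - y k)\<close>, since \<open>u\<close> is orthogonal to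
  \<open>y k\<close>, so Cauchy-Schwarz bounds it by the size of the perturbation.\<close>

lemma unit_normal_near_basis_vector:
  fixes e :: "'a::euclidean_space"
  assumes "e \<in> Basis" "finite J" "inj_on h J" "h ` J \<subseteq> Basis - {e}"
  obtains u :: 'a where "norm u = 1" "\<And>k. k \<in> J \<Longrightarrow> u \<bullet> y k = 0"
    "(\<Sum>b\<in>Basis - {e}. \<bar>u \<bullet> b\<bar>) \<le> (\<Sum>k\<in>J. norm (h k - y k))"
proof -
  define R where "R = Basis - {e} - h ` J"
  have "card (y ` J \<union> R) \<le> card (y ` J) + card R"
    by (rule card_Un_le)
  also have "\<dots> \<le> card (h ` J) + card R"
    using assms(2,3) by (simp add: card_image card_image_le)
  also have "\<dots> = card (Basis - {e})"
    unfolding R_def using assms(4)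
    by (metis card_Diff_subset card_mono finite_Basis finite_Diff finite_subset le_add_diff_inverse)
  also have "\<dots> < DIM('a)"
    using assms(1) by (intro psubset_card_mono) auto
  finally have "dim (y ` J \<union> R) < DIM('a)"
    using dim_le_card'[of "y ` J \<union> R"] assms(2) by (simp add: R_def)
  then obtain w :: 'a where w: "w \<noteq> 0" "\<And>z. z \<in> span (y ` J \<union> R) \<Longrightarrow> orthogonal w z"
    using orthogonal_to_subspace_exists by blast
  define u where "u = sgn w"
  have norm_u: "norm u = 1"
    using w(1) by (simp add: u_def norm_sgn)
  have orth: "u \<bullet> z = 0" if "z \<in> y ` J \<union> R" for z
    using w(2)[OF span_base[OF that]] by (simp add: u_def sgn_div_norm orthogonal_def)
  have "(\<Sum>b\<in>Basis - {e}. \<bar>u \<bullet> b\<bar>) = (\<Sum>b\<in>h ` J. \<bar>u \<bullet> b\<bar>)"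
    using assms(4) orth by (intro sum.mono_neutral_right) (auto simp: R_def)
  also have "\<dots> = (\<Sum>k\<in>J. \<bar>u \<bullet> h k\<bar>)"
    using assms(3) by (simp add: sum.reindex)
  also have "\<dots> \<le> (\<Sum>k\<in>J. norm (h k - y k))"
  proof (rule sum_mono)
    fix k assume "k \<in> J"
    then have "u \<bullet> h k = u \<bullet> (h k - y k)"
      using orth by (simp add: inner_diff_right)
    then show "\<bar>u \<bullet> h k\<bar> \<le> norm (h k - y k)"
      using Cauchy_Schwarz_ineq2[of u "h k - y k"] norm_u by simp
  qed
  finally show thesis
    using that norm_u orth by blast
qed

text \<open>In \<open>u \<bullet> v\<close> the term along \<open>e\<close> outweighs all the
  others: both squared \<open>e\<close>-coordinates exceed 1/2, so their product exceeds 1/2 in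
  absolute value, whereas the remaining terms add up to less than 1/2.\<close>

lemma unit_vectors_near_basis_vector_not_orthogonal:
  fixes u v e :: "'a::euclidean_space"
  assumes e: "e \<in> Basis" and "norm u = 1" "norm v = 1"
    and u: "(\<Sum>b\<in>Basis - {e}. \<bar>u \<bullet> b\<bar>) < 1/2"
    and v: "(\<Sum>b\<in>Basis - {e}. \<bar>v \<bullet> b\<bar>) < 1/2"
  shows "u \<bullet> v \<noteq> 0"
proof -
  have split: "a \<bullet> c = (a \<bullet> e) * (c \<bullet> e) + (\<Sum>b\<in>Basis - {e}. (a \<bullet> b) * (c \<bullet> b))" for a c :: 'a
    using e by (simp add: euclidean_inner[of a c] sum.remove)
  have small: "\<bar>\<Sum>b\<in>Basis - {e}. (a \<bullet> b) * (c \<bullet> b)\<bar> < 1/2"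
    if "(\<Sum>b\<in>Basis - {e}. \<bar>a \<bullet> b\<bar>) < 1/2" "norm c = 1" for a c :: 'a
  proof -
    have "\<bar>\<Sum>b\<in>Basis - {e}. (a \<bullet> b) * (c \<bullet> b)\<bar> \<le> (\<Sum>b\<in>Basis - {e}. \<bar>(a \<bullet> b) * (c \<bullet> b)\<bar>)"
      by (rule sum_abs)
    also have "\<dots> \<le> (\<Sum>b\<in>Basis - {e}. \<bar>a \<bullet> b\<bar>)"
      using Basis_le_norm[of _ c] \<open>norm c = 1\<close>
      by (intro sum_mono) (auto simp: abs_mult intro!: mult_left_le)
    finally show ?thesis
      using that(1) by linarith
  qed
  have large: "1/2 < (a \<bullet> e)\<^sup>2"
    if "(\<Sum>b\<in>Basis - {e}. \<bar>a \<bullet> b\<bar>) < 1/2" "norm a = 1" for a :: 'a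
    using split[of a a] small[OF that] that(2) by (simp add: norm_eq_1 power2_eq_square)
  have "1/2 * (1/2) < (u \<bullet> e)\<^sup>2 * (v \<bullet> e)\<^sup>2"
    using large[OF u assms(2)] large[OF v assms(3)] by (intro mult_strict_mono) linarith+
  then have "(1/2)\<^sup>2 < \<bar>(u \<bullet> e) * (v \<bullet> e)\<bar>\<^sup>2"
    by (simp add: power_mult_distrib power2_eq_square[of "1/2"])
  then have "1/2 < \<bar>(u \<bullet> e) * (v \<bullet> e)\<bar>"
    by (rule power_less_imp_less_base) simp
  then show ?thesis
    using split[of u v] small[OF u assms(3)] by linarith
qed

lemma norm_retrieval_not_dense:
  fixes m :: nat
  assumes "m \<le> 2 * (DIM('a::euclidean_space) - 1)"
  shows "\<exists>x :: nat \<Rightarrow> 'a. \<forall>y. (\<Sum>k=1..m. norm (x k - y k)) < 1/2 \<longrightarrow> \<not> norm_retrieval_on {1..m} y"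
proof -
  obtain e :: 'a where e: "e \<in> Basis"
    using nonempty_Basis by blast
  define d where "d = DIM('a) - 1"
  have "card {1..d} = card (Basis - {e})"
    using e by (simp add: d_def)
  then obtain g where "bij_betw g {1..d} (Basis - {e})"
    using finite_same_card_bij[of "{1..d}" "Basis - {e}"] by auto
  then have g: "inj_on g {1..d}" "g ` {1..d} = Basis - {e}"
    unfolding bij_betw_def by blast+
  \<comment> \<open>The indices from 1 to \<open>d\<close> run once through
    \<open>Basis - {e}\<close>, and those after \<open>d\<close> start over, so repetitions occur
    only between the two blocks.\<close>
  define x where "x k = (if k \<le> d then g k else g (k - d))" for k
  \<comment> \<open>The minimum keeps \<open>J\<close> inside \<open>{1..m}\<close> when
    \<open>m < d\<close>; then \<open>K\<close> is empty.\<close>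
  define J where "J = {1..min m d}"
  define K where "K = {d<..m}"
  have J: "finite J" "inj_on x J" "x ` J \<subseteq> Basis - {e}"
  proof -
    have sub: "J \<subseteq> {1..d}" and xg: "\<And>k. k \<in> J \<Longrightarrow> x k = g k"
      by (auto simp: J_def x_def)
    show "finite J" by (simp add: J_def)
    show "inj_on x J"
      using inj_on_subset[OF g(1) sub] by (simp add: inj_on_def xg)
    have "x ` J = g ` J"
      using xg by (rule image_cong[OF refl])
    then show "x ` J \<subseteq> Basis - {e}"
      unfolding g(2)[symmetric] using image_mono[OF sub, of g] by (rule ord_eq_le_trans)
  qed
  \<comment> \<open>The bound on \<open>m\<close> enters here: it says \<open>m \<le> 2 * d\<close>,
    so the second block does not run past the end of the basis.\<close>
  have shift: "k - d \<in> {1..d}" if "k \<in> K" for k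
    using that assms by (auto simp: K_def d_def)
  have K: "finite K" "inj_on x K" "x ` K \<subseteq> Basis - {e}"
  proof -
    show "finite K" by (simp add: K_def)
    show "inj_on x K"
    proof (rule inj_onI)
      fix k l assume kl: "k \<in> K" "l \<in> K" "x k = x l"
      then have "k - d = l - d"
        by (intro inj_onD[OF g(1) _ shift shift]) (simp_all add: K_def x_def)
      \<comment> \<open>Subtraction on naturals truncates, but both indices exceed
        \<open>d\<close>.\<close>
      then show "k = l" using kl by (auto simp: K_def)
    qed
    show "x ` K \<subseteq> Basis - {e}"
    proof (rule image_subsetI)
      fix k assume "k \<in> K"
      then have "x k = g (k - d)"
        by (simp add: K_def x_def)
      then show "x k \<in> Basis - {e}"
        using g(2) shift[OF \<open>k \<in> K\<close>] by blast
    qed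
  qed
  have "\<not> norm_retrieval_on {1..m} y" if y: "(\<Sum>k=1..m. norm (x k - y k)) < 1/2" for y
  proof
    assume nr: "norm_retrieval_on {1..m} y"
    \<comment> \<open>Each block inherits the bound on the total perturbation, which is why 1/2
      suffices as the radius.\<close>
    have part: "(\<Sum>k\<in>L. norm (x k - y k)) < 1/2" if "L \<subseteq> {1..m}" for L
      using sum_mono2[OF _ that, of "\<lambda>k. norm (x k - y k)"] y by auto
    obtain u where u: "norm u = 1" "\<And>k. k \<in> J \<Longrightarrow> u \<bullet> y k = 0"
        "(\<Sum>b\<in>Basis - {e}. \<bar>u \<bullet> b\<bar>) \<le> (\<Sum>k\<in>J. norm (x k - y k))"
      using unit_normal_near_basis_vector[OF e J] by blast
    obtain v where v: "norm v = 1" "\<And>k. k \<in> K \<Longrightarrow> v \<bullet> y k = 0"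
        "(\<Sum>b\<in>Basis - {e}. \<bar>v \<bullet> b\<bar>) \<le> (\<Sum>k\<in>K. norm (x k - y k))"
      using unit_normal_near_basis_vector[OF e K] by blast
    have "u \<bullet> v \<noteq> 0"
      using e u(1) v(1)
    proof (rule unit_vectors_near_basis_vector_not_orthogonal)
      show "(\<Sum>b\<in>Basis - {e}. \<bar>u \<bullet> b\<bar>) < 1/2"
        using u(3) part[of J] by (rule order_le_less_trans) (auto simp: J_def)
      show "(\<Sum>b\<in>Basis - {e}. \<bar>v \<bullet> b\<bar>) < 1/2"
        using v(3) part[of K] by (rule order_le_less_trans) (auto simp: K_def)
    qed
    moreover have "{1..m} \<subseteq> J \<union> K"
      by (auto simp: J_def K_def)
    ultimately show False
      using norm_retrieval_on_orthogonal[OF nr _ u(2) v(2)] by blast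
  qed
  then show ?thesis by blast
qed

theorem mainTheorem1:
  fixes m :: nat
  assumes "2 \<le> CARD('n::finite)"
    and "1 \<le> m"
    and "m \<le> 2 * CARD('n) - 2"
  shows "\<exists>(x :: nat \<Rightarrow> real ^ 'n) \<epsilon>::real. 0 < \<epsilon> \<and>
    \<not> (\<exists>y :: nat \<Rightarrow> real ^ 'n.
        (\<Sum>k=1..m. norm (x k - y k)) < \<epsilon> \<and>
        frame_on {1..m} y \<and> norm_retrieval_on {1..m} y)"
proof -
  have "m \<le> 2 * (DIM(real ^ 'n) - 1)"
    using assms(3) by simp
  from norm_retrieval_not_dense[OF this] obtain x :: "nat \<Rightarrow> real ^ 'n" where
    "\<forall>y. (\<Sum>k=1..m. norm (x k - y k)) < 1/2 \<longrightarrow> \<not> norm_retrieval_on {1..m} y"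
    by blast
  then show ?thesis
    by (intro exI[of _ x] exI[of _ "1/2"]) auto
qed

end
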